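(* Under the assumptions on the domain, the materials, the boundary conditions and the discretisation stated in the context, the semidiscrete electroquasistatic system $$\widetilde{\mathbf{S}}\mathbf{M}_\sigma\widetilde{\mathbf{S}}^\top\boldsymbol\Phi+\widetilde{\mathbf{S}}\mathbf{M}_\varepsilon\widetilde{\mathbf{S}}^\top\frac{\mathrm d}{\mathrm dt}\boldsymbol\Phi=0$$ for the electric scalar potential $\boldsymbol\Phi$ is a system of ordinary differential equations (i.e. the matrix $\widetilde{\mathbf{S}}\mathbf{M}_\varepsilon\widetilde{\mathbf{S}}^\top$ is nonsingular).
   Context: Domain: $\Omega\subset\mathbb{R}^3$ is open, bounded, Lipschitz and contractible. Materials: the permittivity $\boldsymbol\varepsilon$ and permeability $\boldsymbol\mu$ are tensor fields $\Omega\to\mathbb{R}^{3\times3}$ depending only on space and positive definite on all of $\Omega$; the conductivity $\boldsymbol\sigma$ is positive definite on a subdomain $\Omega_{\mathrm c}\subset\Omega$ and vanishes elsewhere; the source current density is supported in $\Omega_{\mathrm s}\subset\Omega$ with $\Omega_{\mathrm c}\cap\Omega_{\mathrm s}=\emptyset$. Discretisation: $\Omega$ is decomposed by a primal grid and a staggered dual grid (Finite Integration Technique, or equivalently lowest-order Whitney finite elements); primal edges correspond to dual facets and primal nodes to dual volumes. $\boldsymbol\Phi$ is the time-dependent vector of values of the electric scalar potential at the primal nodes. $\widetilde{\mathbf{S}}$ is the discrete divergence matrix on the dual grid (entries in $\{-1,0,1\}$), and $-\widetilde{\mathbf{S}}^\top$ is the discrete gradient on the primal grid. Boundary conditions: all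 degrees of freedom and operators are restricted to the subspace in which homogeneous electric (Dirichlet) boundary conditions are incorporated and superfluous objects outside the domain are removed; therefore $\ker\widetilde{\mathbf{S}}^\top=\{0\}$. The material matrices $\mathbf{M}_\varepsilon$ and $\mathbf{M}_\sigma$ (acting on primal edge quantities) are symmetric; given that $\boldsymbol\varepsilon$ depends only on space and is positive definite on all of $\Omega$, and that $\boldsymbol\sigma$ is positive definite on $\Omega_{\mathrm c}$ and vanishes elsewhere, $\mathbf{M}_\varepsilon$ is positive definite and $\mathbf{M}_\sigma$ is positive semidefinite. A linear system $\mathbf{M}\frac{\mathrm d}{\mathrm dt}\mathbf{x}+\mathbf{K}\mathbf{x}=\mathbf{r}$ is called a system of differential-algebraic equations if $\mathbf{M}$ is singular; otherwise it is a system of ordinary differential equations (ODE). *)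

theory Defs
  imports "HOL-Analysis.Analysis"
begin

section \<open>Domain and materials\<close>

text \<open>
  Near each boundary point the domain is, in suitable Cartesian coordinates, the strict epigraph of
  a Lipschitz function. The vertical axis is the unit vector \<open>u\<close>, and \<open>x - (x \<bullet> u) *\<^sub>R u\<close> is the
  horizontal part of \<open>x\<close>.
\<close>

definition lipschitz_domain :: "(real^3) set \<Rightarrow> bool" where
  "lipschitz_domain \<Omega> \<longleftrightarrow>
    (\<forall>p \<in> frontier \<Omega>. \<exists>U u L g. open U \<and> p \<in> U \<and> norm u = 1 \<and>
       L-lipschitz_on {y. y \<bullet> u = 0} (g :: real^3 \<Rightarrow> real) \<and>
       \<Omega> \<inter> U = {x \<in> U. g (x - (x \<bullet> u) *\<^sub>R u) < x \<bullet> u})"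

text \<open>Symmetry is not part of the following two notions; it is stated separately where needed.\<close>

definition pos_def :: "real^'k^'k \<Rightarrow> bool" where
  "pos_def A \<longleftrightarrow> (\<forall>x. x \<noteq> 0 \<longrightarrow> 0 < x \<bullet> (A *v x))"

definition pos_semidef :: "real^'k^'k \<Rightarrow> bool" where
  "pos_semidef A \<longleftrightarrow> (\<forall>x. 0 \<le> x \<bullet> (A *v x))"

definition pos_def_field :: "(real^3) set \<Rightarrow> (real^3 \<Rightarrow> real^3^3) \<Rightarrow> bool" where
  "pos_def_field D \<alpha> \<longleftrightarrow> (\<forall>x \<in> D. pos_def (\<alpha> x))"

definition conductivity_field ::
    "(real^3) set \<Rightarrow> (real^3) set \<Rightarrow> (real^3 \<Rightarrow> real^3^3) \<Rightarrow> bool" where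
  "conductivity_field \<Omega> \<Omega>c \<sigma> \<longleftrightarrow> pos_def_field \<Omega>c \<sigma> \<and> (\<forall>x \<in> \<Omega> - \<Omega>c. \<sigma> x = 0)"


section \<open>Primal and dual grid\<close>

definition polytopal_complex :: "(real^3) set set \<Rightarrow> bool" where
  "polytopal_complex C \<longleftrightarrow>
     finite C \<and> (\<forall>K \<in> C. polytope K) \<and>
     (\<forall>K \<in> C. \<forall>F. F face_of K \<longrightarrow> F \<in> C) \<and>
     (\<forall>K \<in> C. \<forall>L \<in> C. (K \<inter> L) face_of K)"

text \<open>
  The cells of the grid are the images \<open>\<psi> ` K\<close> of the cells of a reference complex, so that curved
  grids of domains that are not polyhedral are included; for straight cells \<open>\<psi>\<close> is the identity.
\<close>

definition decomposes ::
    "(real^3) set set \<Rightarrow> (real^3 \<Rightarrow> real^3) \<Rightarrow> (real^3) set \<Rightarrow> bool" where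
  "decomposes C \<psi> \<Omega> \<longleftrightarrow>
     polytopal_complex C \<and> (\<exists>\<psi>'. homeomorphism (\<Union>C) (closure \<Omega>) \<psi> \<psi>')"

text \<open>
  Degrees of freedom under homogeneous Dirichlet conditions on the whole boundary. The finite types
  \<open>'n\<close> and \<open>'e\<close> enumerate the primal nodes and edges that do not lie on the boundary; equivalently
  they enumerate the dual volumes and dual facets. Nodes and the end points of the edges are given
  by their position in the reference complex. Edge \<open>e\<close> is oriented from \<open>tail e\<close> to \<open>head e\<close>; one or
  both of these may be boundary nodes, which carry no degree of freedom.
\<close>

definition dirichlet_dofs ::
    "(real^3) set set \<Rightarrow> (real^3 \<Rightarrow> real^3) \<Rightarrow> (real^3) set \<Rightarrow>
     ('n \<Rightarrow> real^3) \<Rightarrow> ('e \<Rightarrow> real^3) \<Rightarrow> ('e \<Rightarrow> real^3) \<Rightarrow> bool" where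
  "dirichlet_dofs C \<psi> \<Omega> node tail head \<longleftrightarrow>
     bij_betw node UNIV {v. {v} \<in> C \<and> \<psi> v \<notin> frontier \<Omega>} \<and>
     bij_betw (\<lambda>e. closed_segment (tail e) (head e)) UNIV
       {E \<in> C. aff_dim E = 1 \<and> \<not> \<psi> ` E \<subseteq> frontier \<Omega>}"

text \<open>
  The dual facet of edge \<open>e\<close> is oriented along \<open>e\<close>, hence out of the dual volume around \<open>tail e\<close> and
  into the one around \<open>head e\<close>.
\<close>

definition dual_divergence ::
    "('n \<Rightarrow> real^3) \<Rightarrow> ('e \<Rightarrow> real^3) \<Rightarrow> ('e \<Rightarrow> real^3) \<Rightarrow> real^'e^'n" where
  "dual_divergence node tail head =
     (\<chi> n e. if node n = tail e then 1 else if node n = head e then - 1 else 0)"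

lemma dual_divergence_entries:
  "dual_divergence node tail head $ n $ e \<in> {- 1, 0, 1}"
  by (simp add: dual_divergence_def)

lemma gradient_of_dual_divergence:
  fixes \<Phi> :: "real^'n"
  assumes "inj node" and "node i = tail e" and "node j = head e" and "tail e \<noteq> head e"
  shows "((- transpose (dual_divergence node tail head)) *v \<Phi>) $ e = \<Phi> $ j - \<Phi> $ i"
proof -
  have ij: "i \<noteq> j" using assms by auto
  have eq: "node k = tail e \<longleftrightarrow> k = i" "node k = head e \<longleftrightarrow> k = j" for k
    using assms by (metis injD)+
  have "((- transpose (dual_divergence node tail head)) *v \<Phi>) $ e =
      (\<Sum>k\<in>UNIV. (if k = j then \<Phi> $ k else 0) - (if k = i then \<Phi> $ k else 0))"
    unfolding matrix_vector_mult_def dual_divergence_def transpose_def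
    using ij by (auto simp: eq intro!: sum.cong)
  also have "\<dots> = \<Phi> $ j - \<Phi> $ i"
    by (simp add: sum_subtractf)
  finally show ?thesis .
qed


section \<open>Linear first-order systems\<close>

text \<open>A record represents the system \<open>M (d/dt) x + K x = r\<close>.\<close>

record 'n linear_system =
  mass :: "real^'n^'n"
  stiffness :: "real^'n^'n"
  rhs :: "real \<Rightarrow> real^'n"

definition solves :: "'n::finite linear_system \<Rightarrow> (real \<Rightarrow> real^'n) \<Rightarrow> real set \<Rightarrow> bool" where
  "solves s x I \<longleftrightarrow>
     (\<forall>t \<in> I. \<exists>x'. (x has_vector_derivative x') (at t within I) \<and>
        mass s *v x' + stiffness s *v x t = rhs s t)"

definition is_DAE_system :: "'n::finite linear_system \<Rightarrow> bool" where
  "is_DAE_system s \<longleftrightarrow> \<not> invertible (mass s)"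

definition is_ODE_system :: "'n::finite linear_system \<Rightarrow> bool" where
  "is_ODE_system s \<longleftrightarrow> \<not> is_DAE_system s"

definition eqs_system ::
    "real^'e^'n \<Rightarrow> real^'e^'e \<Rightarrow> real^'e^'e \<Rightarrow> 'n::finite linear_system" where
  "eqs_system S M\<sigma> M\<epsilon> =
     \<lparr> mass = S ** M\<epsilon> ** transpose S,
       stiffness = S ** M\<sigma> ** transpose S,
       rhs = (\<lambda>t. 0) \<rparr>"

lemma solves_eqs_system:
  "solves (eqs_system S M\<sigma> M\<epsilon>) \<Phi> I \<longleftrightarrow>
     (\<forall>t \<in> I. \<exists>\<Phi>'. (\<Phi> has_vector_derivative \<Phi>') (at t within I) \<and>
        (S ** M\<sigma> ** transpose S) *v \<Phi> t + (S ** M\<epsilon> ** transpose S) *v \<Phi>' = 0)"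
  by (simp add: solves_def eqs_system_def add.commute)

end

theory Submission
  imports Defs
begin

text \<open>
  Since \<open>M\<epsilon>\<close> is positive definite, it suffices that the discrete gradient has trivial kernel. Suppose
  a potential in the kernel is nonzero at some node, and take such a node \<open>v\<close> that is highest in a
  fixed direction \<open>c\<close>. By invariance of domain \<open>v\<close> is an interior point of the reference complex, so
  some cell at \<open>v\<close> reaches above \<open>v\<close>, and as in the simplex algorithm that cell has an edge from \<open>v\<close>
  to a higher vertex \<open>w\<close>. The potential has the same value at both ends of this edge, but it vanishes
  at \<open>w\<close>, which is either a boundary node or too high.
\<close>

section \<open>Edges of a polytope at a vertex\<close>

text \<open>Descent through facets: if \<open>K\<close> has dimension above 1, then \<open>v\<close>
  lies in a facet, which has one dimension less and still has \<open>v\<close> as an extreme point;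
  the descent ends at dimension 1.\<close>

lemma polytope_vertex_in_edge:
  fixes K :: "'a::euclidean_space set"
  assumes "polytope K" and "v extreme_point_of K" and "1 \<le> aff_dim K"
  shows "\<exists>E. E face_of K \<and> v \<in> E \<and> aff_dim E = 1"
  using assms
proof (induction "nat (aff_dim K)" arbitrary: K rule: less_induct)
  case less
  show ?case
  proof (cases "aff_dim K = 1")
    case True
    with less.prems show ?thesis
      by (metis extreme_point_of_def face_of_refl polytope_imp_convex)
  next
    case False
    have v: "{v} face_of K" using less.prems by (simp add: face_of_singleton)
    have "{v} \<noteq> K" using less.prems by auto
    then obtain F where F: "F facet_of K" "v \<in> F"
      using face_of_polyhedron_subset_facet[OF polytope_imp_polyhedron[OF less.prems(1)] v] by auto
    have dim: "aff_dim F = aff_dim K - 1" and face: "F face_of K"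
      using F by (auto simp: facet_of_def)
    have "v extreme_point_of F"
      using extreme_point_of_face[OF face] F less.prems by simp
    moreover have "polytope F" using face_of_polytope_polytope less.prems face by blast
    ultimately obtain E where "E face_of F" "v \<in> E" "aff_dim E = 1"
      using less.hyps[of F] dim False less.prems(3) by fastforce
    with face show ?thesis using face_of_trans by blast
  qed
qed

text \<open>
  Let the functional \<open>a\<close> expose \<open>v\<close> as a minimum. The vertices \<open>w\<close> maximizing
  the slope of \<open>c\<close> against \<open>a\<close>, together with \<open>v\<close>, span a face on which \<open>c\<close> exceeds its value
  at \<open>v\<close> everywhere else, and any edge of that face at \<open>v\<close> will do.
\<close>

lemma polytope_improving_edge:
  fixes K :: "'a::euclidean_space set"
  assumes K: "polytope K" and v: "v extreme_point_of K"
    and x: "x \<in> K" "c \<bullet> v < c \<bullet> x"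
  obtains w where "closed_segment v w face_of K" "c \<bullet> v < c \<bullet> w"
proof -
  define V where "V = {w. w extreme_point_of K}"
  have hull: "K = convex hull V"
    unfolding V_def
    by (rule Krein_Milman_Minkowski[OF polytope_imp_compact[OF K] polytope_imp_convex[OF K]])
  have finV: "finite V"
    unfolding V_def by (rule finite_polyhedron_extreme_points[OF polytope_imp_polyhedron[OF K]])
  have "{v} face_of K" using v by (simp add: face_of_singleton)
  then have "{v} exposed_face_of K"
    by (simp add: exposed_face_of_polyhedron[OF polytope_imp_polyhedron[OF K]])
  then obtain a0 b where a0: "K \<subseteq> {x. a0 \<bullet> x \<le> b}" "{v} = K \<inter> {x. a0 \<bullet> x = b}"
    unfolding exposed_face_of_def by auto
  \<comment> \<open>On \<open>K\<close> the functional \<open>a0\<close> attains its maximum exactly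
    at \<open>v\<close>; the sign change makes the denominators of the slopes below
    positive.\<close>
  define a where "a = - a0"
  have a_pos: "0 < a \<bullet> (y - v)" if "y \<in> K" "y \<noteq> v" for y
  proof -
    have "v \<in> K \<inter> {x. a0 \<bullet> x = b}" "y \<notin> K \<inter> {x. a0 \<bullet> x = b}"
      unfolding a0(2)[symmetric] using that by simp_all
    moreover have "a0 \<bullet> y \<le> b" using that(1) a0(1) by auto
    ultimately show ?thesis using that(1) by (simp add: a_def inner_diff_right)
  qed
  have VK: "V \<subseteq> K" unfolding V_def by (auto simp: extreme_point_of_def)
  have halfspace: "K \<subseteq> {y. f \<bullet> y \<le> b}" if "V \<subseteq> {y. f \<bullet> y \<le> b}" for f b
    by (subst hull) (rule hull_minimal[of V _ convex, OF that convex_halfspace_le])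
  obtain w0 where w0: "w0 \<in> V" "c \<bullet> v < c \<bullet> w0"
  proof -
    have "\<not> V \<subseteq> {y. c \<bullet> y \<le> c \<bullet> v}"
      using halfspace[of c "c \<bullet> v"] x by force
    then have "\<exists>w\<in>V. c \<bullet> v < c \<bullet> w" by (simp add: subset_eq not_le)
    then show thesis using that by blast
  qed
  define s where "s w = (c \<bullet> (w - v)) / (a \<bullet> (w - v))" for w
  define W where "W = V - {v}"
  have W: "w0 \<in> W" "finite W" using w0 finV by (auto simp: W_def)
  then have "Max (s ` W) \<in> s ` W" by (intro Max_in) auto
  then obtain w1 where w1: "w1 \<in> W" "Max (s ` W) = s w1" by (rule imageE)
  have max: "s w \<le> s w1" if "w \<in> W" for w
    using that W Max_ge[of "s ` W" "s w"] w1 by simp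
  define l where "l = s w1"
  have "0 < c \<bullet> (w0 - v)" "0 < a \<bullet> (w0 - v)"
    using a_pos[of w0] w0 VK by (auto simp: inner_diff_right)
  then have "0 < s w0" by (simp add: s_def)
  then have l: "0 < l" using max[OF W(1)] unfolding l_def by linarith
  \<comment> \<open>Since \<open>l\<close> is the largest slope of a vertex, \<open>f\<close> is
    maximal over \<open>K\<close> at \<open>v\<close>, with a tie at \<open>w1\<close>. On the face
    of ties, \<open>c\<close> and \<open>l *\<^sub>R a\<close> differ by a constant, so
    \<open>c\<close> grows away from \<open>v\<close> as \<open>a\<close> does.\<close>
  define f where "f = c - l *\<^sub>R a"
  have f_V: "f \<bullet> w \<le> f \<bullet> v" if "w \<in> V" for w
  proof (cases "w = v")
    case False
    then have "0 < a \<bullet> (w - v)" "s w \<le> l"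
      using a_pos[OF subsetD[OF VK that]] max[of w] that by (auto simp: l_def W_def)
    then have "c \<bullet> (w - v) \<le> l * (a \<bullet> (w - v))" by (simp add: s_def pos_divide_le_eq)
    then show ?thesis by (simp add: f_def inner_diff_left inner_diff_right algebra_simps)
  qed simp
  then have f_le: "f \<bullet> y \<le> f \<bullet> v" if "y \<in> K" for y
    using halfspace[of f "f \<bullet> v"] that by auto
  define F where "F = K \<inter> {y. f \<bullet> y = f \<bullet> v}"
  have F: "F face_of K"
    unfolding F_def
    by (rule face_of_Int_supporting_hyperplane_le[OF polytope_imp_convex[OF K] f_le])
  have vF: "v \<in> F" unfolding F_def using v by (auto simp: extreme_point_of_def)
  have c_F: "c \<bullet> v < c \<bullet> y" if "y \<in> F" "y \<noteq> v" for y
  proof -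
    have "c \<bullet> (y - v) = l * (a \<bullet> (y - v))"
      using that by (simp add: F_def f_def inner_diff_left inner_diff_right algebra_simps)
    also have "\<dots> > 0" using that a_pos l by (simp add: F_def)
    finally show ?thesis by (simp add: inner_diff_right)
  qed
  have w1: "w1 \<in> V" "w1 \<noteq> v" using w1 by (auto simp: W_def)
  have "w1 \<in> F"
  proof -
    have "0 < a \<bullet> (w1 - v)" using a_pos[OF subsetD[OF VK w1(1)] w1(2)] .
    then have "c \<bullet> (w1 - v) = l * (a \<bullet> (w1 - v))" by (simp add: l_def s_def)
    then show ?thesis using w1 VK
      by (auto simp: F_def f_def inner_diff_left inner_diff_right algebra_simps)
  qed
  have "1 \<le> aff_dim F"
  proof -
    have "aff_dim {v, w1} \<le> aff_dim F" using vF \<open>w1 \<in> F\<close> by (intro aff_dim_subset) auto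
    then show ?thesis using w1 by (simp add: aff_dim_2)
  qed
  moreover have "v extreme_point_of F" using extreme_point_of_face[OF F] vF v by simp
  moreover have "polytope F" using face_of_polytope_polytope K F by blast
  ultimately obtain E where E: "E face_of F" "v \<in> E" "aff_dim E = 1"
    using polytope_vertex_in_edge by blast
  have EK: "E face_of K" using E F face_of_trans by blast
  then have "polytope E" using face_of_polytope_polytope K by blast
  \<comment> \<open>A compact convex set of dimension 1 is a segment, and its extreme point
    \<open>v\<close> must be one of the two ends.\<close>
  then have "compact E" "convex E" by (auto intro: polytope_imp_compact polytope_imp_convex)
  moreover have "E \<noteq> {}" "collinear E" using E by (auto simp: collinear_aff_dim)
  ultimately obtain p q where pq: "E = closed_segment p q"
    by (meson compact_convex_collinear_segment)
  have "v extreme_point_of E" using extreme_point_of_face[OF EK] E v by simp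
  then have "v = p \<or> v = q" using pq by (simp add: extreme_point_of_segment)
  then obtain w where w: "E = closed_segment v w" using pq closed_segment_commute by metis
  have "w \<noteq> v" using E w by auto
  moreover have "w \<in> F" using E w face_of_imp_subset by blast
  ultimately show thesis using that EK w c_F by blast
qed

section \<open>Interior points of the reference complex\<close>

text \<open>For small positive \<open>t\<close> the point \<open>v + t *\<^sub>R c\<close> stays in
  the union and avoids the closed union of the finitely many members missing \<open>v\<close>, so it
  lies in a member that contains \<open>v\<close>.\<close>

lemma finite_closed_cover_direction:
  fixes v c :: "'a::real_normed_vector"
  assumes "finite C" and "\<And>K. K \<in> C \<Longrightarrow> closed K" and "v \<in> interior (\<Union>C)"
  obtains K t where "K \<in> C" "v \<in> K" "0 < t" "v + t *\<^sub>R c \<in> K"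
proof -
  define h where "h t = v + t *\<^sub>R c" for t :: real
  have h: "(h \<longlongrightarrow> v) (at_right 0)"
    unfolding h_def by (auto intro!: tendsto_eq_intros)
  have "\<forall>\<^sub>F t in at_right 0. h t \<in> interior (\<Union>C)"
    using topological_tendstoD[OF h open_interior assms(3)] .
  moreover have "\<forall>\<^sub>F t in at_right 0. h t \<notin> \<Union>{K \<in> C. v \<notin> K}"
  proof -
    have "open (- \<Union>{K \<in> C. v \<notin> K})" using assms by (auto intro!: closed_Union)
    from topological_tendstoD[OF h this] show ?thesis by (auto elim: eventually_mono)
  qed
  moreover have "\<forall>\<^sub>F t in at_right (0::real). 0 < t" by (rule eventually_at_right_less)
  ultimately have "\<forall>\<^sub>F t in at_right 0. 0 < t \<and> h t \<in> \<Union>C \<and> h t \<notin> \<Union>{K \<in> C. v \<notin> K}"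
    by eventually_elim (use interior_subset in blast)
  then have "\<exists>t. 0 < t \<and> h t \<in> \<Union>C \<and> h t \<notin> \<Union>{K \<in> C. v \<notin> K}"
    using eventually_happens'[OF trivial_limit_at_right_real] by blast
  then show thesis using that unfolding h_def by blast
qed

lemma polytopal_complex_improving_edge:
  assumes C: "polytopal_complex C" and v: "{v} \<in> C" "v \<in> interior (\<Union>C)" and "c \<noteq> 0"
  obtains w where "closed_segment v w \<in> C" "{w} \<in> C" "c \<bullet> v < c \<bullet> w"
proof -
  have poly: "\<And>K. K \<in> C \<Longrightarrow> polytope K" and fin: "finite C"
    and faces: "\<And>K F. K \<in> C \<Longrightarrow> F face_of K \<Longrightarrow> F \<in> C"
    and inter: "\<And>K L. K \<in> C \<Longrightarrow> L \<in> C \<Longrightarrow> (K \<inter> L) face_of K"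
    using C unfolding polytopal_complex_def by blast+
  obtain K t where K: "K \<in> C" "v \<in> K" "0 < t" "v + t *\<^sub>R c \<in> K"
    using finite_closed_cover_direction[OF fin _ v(2)] poly polytope_imp_closed by metis
  \<comment> \<open>Cells meet in common faces, so the cell \<open>{v}\<close> is a face of
    \<open>K\<close>.\<close>
  have "K \<inter> {v} = {v}" using K by blast
  then have "v extreme_point_of K" using inter[OF K(1) v(1)] by (simp add: face_of_singleton)
  moreover have "c \<bullet> v < c \<bullet> (v + t *\<^sub>R c)"
    using K \<open>c \<noteq> 0\<close> by (simp add: inner_add_right)
  ultimately obtain w where w: "closed_segment v w face_of K" "c \<bullet> v < c \<bullet> w"
    using polytope_improving_edge[OF poly[OF K(1)]] K by metis
  have "{w} face_of closed_segment v w"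
    by (simp add: face_of_singleton extreme_point_of_segment)
  then show thesis using that w faces K by meson
qed

text \<open>The inverse homeomorphism maps the open set \<Omega> injectively and continuously into
  the same space, so by invariance of domain its image is an open neighbourhood of \<open>v\<close>
  inside the complex.\<close>

lemma decomposes_interior:
  assumes "decomposes C \<psi> \<Omega>" and "open \<Omega>" and "v \<in> \<Union>C" and "\<psi> v \<notin> frontier \<Omega>"
  shows "v \<in> interior (\<Union>C)"
proof -
  obtain \<psi>' where h: "homeomorphism (\<Union>C) (closure \<Omega>) \<psi> \<psi>'"
    using assms(1) unfolding decomposes_def by blast
  have im: "\<psi>' ` closure \<Omega> = \<Union>C" "\<psi>' (\<psi> v) = v" "\<psi> v \<in> closure \<Omega>"
    using homeomorphism_image1[OF h] homeomorphism_image2[OF h] homeomorphism_apply1[OF h]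
      assms(3) by auto
  have "\<psi> v \<in> \<Omega>" using im assms by (auto simp: frontier_def interior_open)
  moreover have "open (\<psi>' ` \<Omega>)"
  proof (intro invariance_of_domain \<open>open \<Omega>\<close>)
    show "continuous_on \<Omega> \<psi>'"
      using homeomorphism_cont2[OF h] closure_subset by (rule continuous_on_subset)
    show "inj_on \<psi>' \<Omega>"
      by (rule inj_on_inverseI[of _ \<psi>]) (use homeomorphism_apply2[OF h] closure_subset in blast)
  qed
  moreover have "\<psi>' ` \<Omega> \<subseteq> \<Union>C" using im closure_subset by blast
  ultimately show ?thesis using im(2) by (intro interiorI[of "\<psi>' ` \<Omega>"]) force+
qed

section \<open>Kernel of the discrete gradient\<close>

text \<open>Extension by zero builds in the homogeneous Dirichlet value at boundary nodes, so edges
  ending there need no separate treatment.\<close>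

definition extended_potential :: "('n \<Rightarrow> real^3) \<Rightarrow> real^'n \<Rightarrow> real^3 \<Rightarrow> real" where
  "extended_potential node \<Phi> p = (\<Sum>n\<in>UNIV. if node n = p then \<Phi> $ n else 0)"

lemma extended_potential_node [simp]:
  "inj node \<Longrightarrow> extended_potential node \<Phi> (node n) = \<Phi> $ n"
  unfolding extended_potential_def by (simp add: inj_eq)

lemma extended_potential_notin [simp]:
  "p \<notin> range node \<Longrightarrow> extended_potential node \<Phi> p = 0"
  unfolding extended_potential_def by (auto intro!: sum.neutral)

text \<open>Distinct end points matter because \<open>dual_divergence\<close> tests the tail first:
  a degenerate edge would get the entry 1 instead of a cancellation.\<close>

lemma transpose_dual_divergence_nth:
  assumes "tail e \<noteq> head e"
  shows "(transpose (dual_divergence node tail head) *v \<Phi>) $ e =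
    extended_potential node \<Phi> (tail e) - extended_potential node \<Phi> (head e)"
  unfolding extended_potential_def matrix_vector_mult_def transpose_def dual_divergence_def
  using assms by (auto simp: sum_subtractf[symmetric] intro!: sum.cong)

lemma ker_transpose_dual_divergence:
  fixes node :: "'n::finite \<Rightarrow> real^3" and \<Phi> :: "real^'n"
  assumes dec: "decomposes C \<psi> \<Omega>" and "open \<Omega>"
    and dofs: "dirichlet_dofs C \<psi> \<Omega> node tail head"
    and ker: "transpose (dual_divergence node tail head) *v \<Phi> = 0"
  shows "\<Phi> = 0"
proof (rule ccontr)
  assume "\<Phi> \<noteq> 0"
  \<comment> \<open>Any nonzero direction would serve.\<close>
  define c :: "real^3" where "c = axis 1 1"
  have "c \<noteq> 0" by (simp add: c_def axis_eq_0_iff)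
  define N where "N = {n. \<Phi> $ n \<noteq> 0}"
  have "N \<noteq> {}" using \<open>\<Phi> \<noteq> 0\<close> unfolding N_def vec_eq_iff by simp
  then have "Max ((\<lambda>n. c \<bullet> node n) ` N) \<in> (\<lambda>n. c \<bullet> node n) ` N" by (intro Max_in) auto
  then obtain n where n: "n \<in> N" "Max ((\<lambda>n. c \<bullet> node n) ` N) = c \<bullet> node n" by (rule imageE)
  have max: "c \<bullet> node m \<le> c \<bullet> node n" if "m \<in> N" for m
    using that Max_ge[of "(\<lambda>n. c \<bullet> node n) ` N" "c \<bullet> node m"] n(2) by simp
  have inj: "inj node" and nodes: "range node = {v. {v} \<in> C \<and> \<psi> v \<notin> frontier \<Omega>}"
    and edges: "range (\<lambda>e. closed_segment (tail e) (head e)) =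
      {E \<in> C. aff_dim E = 1 \<and> \<not> \<psi> ` E \<subseteq> frontier \<Omega>}"
    using dofs unfolding dirichlet_dofs_def bij_betw_def by simp_all
  have "node n \<in> {v. {v} \<in> C \<and> \<psi> v \<notin> frontier \<Omega>}" unfolding nodes[symmetric] by (rule rangeI)
  then have v: "{node n} \<in> C" "\<psi> (node n) \<notin> frontier \<Omega>" by simp_all
  then have "node n \<in> interior (\<Union>C)" using decomposes_interior[OF dec \<open>open \<Omega>\<close>] by blast
  moreover have "polytopal_complex C" using dec by (simp add: decomposes_def)
  ultimately obtain w where w: "closed_segment (node n) w \<in> C" "{w} \<in> C" "c \<bullet> node n < c \<bullet> w"
    using polytopal_complex_improving_edge v \<open>c \<noteq> 0\<close> by metis
  then have "node n \<noteq> w" by auto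
  then have "aff_dim (closed_segment (node n) w) = 1"
    by (simp add: segment_convex_hull aff_dim_convex_hull aff_dim_2)
  \<comment> \<open>The end \<open>node n\<close> is not mapped to the boundary, so the whole edge
    is not either and it carries a degree of freedom.\<close>
  moreover have "\<not> \<psi> ` closed_segment (node n) w \<subseteq> frontier \<Omega>" using v by auto
  ultimately have "closed_segment (node n) w \<in> range (\<lambda>e. closed_segment (tail e) (head e))"
    unfolding edges using w(1) by simp
  then obtain e where "closed_segment (node n) w = closed_segment (tail e) (head e)"
    by (rule rangeE)
  \<comment> \<open>The segment determines its end points only as a set; the orientation of
    \<open>e\<close> stays open.\<close>
  then have e: "{tail e, head e} = {node n, w}" by (simp add: closed_segment_eq)
  then have "tail e \<noteq> head e" using \<open>node n \<noteq> w\<close> by auto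
  from transpose_dual_divergence_nth[of tail e head, OF this, of node \<Phi>]
  have "extended_potential node \<Phi> (tail e) = extended_potential node \<Phi> (head e)"
    using ker by simp
  then have "extended_potential node \<Phi> w = extended_potential node \<Phi> (node n)"
    using e by (auto simp: doubleton_eq_iff)
  then have eq: "extended_potential node \<Phi> w \<noteq> 0" using n inj by (simp add: N_def)
  \<comment> \<open>A nonzero value rules out a boundary node, so \<open>w\<close> is a node of
    \<open>N\<close> higher than the highest one.\<close>
  then obtain m where m: "w = node m" using extended_potential_notin by (metis rangeE)
  then have "m \<in> N" using eq inj by (simp add: N_def)
  then show False using max[of m] w(3) m by simp
qed

section \<open>Nonsingularity of the mass matrix\<close>

text \<open>The quadratic form of the product at \<open>x\<close> is that of \<open>M\<close> at
  \<open>transpose S *v x\<close>, which is nonzero for \<open>x \<noteq> 0\<close>. Hence the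
  square product has trivial kernel.\<close>

lemma pos_def_congruence_invertible:
  fixes S :: "real^'e^'n"
  assumes "pos_def M" and ker: "\<And>x. transpose S *v x = 0 \<Longrightarrow> x = 0"
  shows "invertible (S ** M ** transpose S)"
proof -
  have "x = 0" if "(S ** M ** transpose S) *v x = 0" for x
  proof (rule ccontr)
    assume "x \<noteq> 0"
    then have "0 < (transpose S *v x) \<bullet> (M *v (transpose S *v x))"
      using assms unfolding pos_def_def by blast
    also have "\<dots> = x \<bullet> ((S ** M ** transpose S) *v x)"
      by (metis dot_lmul_matrix matrix_vector_mul_assoc transpose_matrix_vector)
    finally show False using that by simp
  qed
  then show ?thesis
    by (metis invertible_left_inverse matrix_left_invertible_ker)
qed

theorem theorem5:
  fixes \<Omega> \<Omega>c \<Omega>s :: "(real^3) set"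
    and \<epsilon> \<mu> \<sigma> :: "real^3 \<Rightarrow> real^3^3"
    and J :: "real \<Rightarrow> real^3 \<Rightarrow> real^3"
    and C :: "(real^3) set set"
    and \<psi> :: "real^3 \<Rightarrow> real^3"
    and node :: "'n::finite \<Rightarrow> real^3"
    and tail head :: "'e::finite \<Rightarrow> real^3"
    and M\<epsilon> M\<sigma> :: "real^'e^'e"
  assumes "open \<Omega>" and "bounded \<Omega>" and "lipschitz_domain \<Omega>" and "contractible \<Omega>"
    and "pos_def_field \<Omega> \<epsilon>" and "pos_def_field \<Omega> \<mu>"
    and "open \<Omega>c" and "\<Omega>c \<subseteq> \<Omega>" and "conductivity_field \<Omega> \<Omega>c \<sigma>"
    and "\<Omega>s \<subseteq> \<Omega>" and "\<Omega>c \<inter> \<Omega>s = {}" and "\<And>t x. x \<notin> \<Omega>s \<Longrightarrow> J t x = 0"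
    and "decomposes C \<psi> \<Omega>"
    and "dirichlet_dofs C \<psi> \<Omega> node tail head"
    and "transpose M\<epsilon> = M\<epsilon>" and "transpose M\<sigma> = M\<sigma>"
    and "pos_def_field \<Omega> \<epsilon> \<Longrightarrow> pos_def M\<epsilon>"
    and "conductivity_field \<Omega> \<Omega>c \<sigma> \<Longrightarrow> pos_semidef M\<sigma>"
  shows "is_ODE_system (eqs_system (dual_divergence node tail head) M\<sigma> M\<epsilon>)"
proof -
  have "pos_def M\<epsilon>" using assms by blast
  moreover have "\<Phi> = 0" if "transpose (dual_divergence node tail head) *v \<Phi> = 0" for \<Phi>
    using ker_transpose_dual_divergence assms that by blast
  ultimately have "invertible (mass (eqs_system (dual_divergence node tail head) M\<sigma> M\<epsilon>))"
    unfolding eqs_system_def by (simp only: linear_system.simps pos_def_congruence_invertible)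
  then show ?thesis by (simp add: is_ODE_system_def is_DAE_system_def)
qed

end
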